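(* Given a nonsingular matrix $M\in\mathbb{C}^{n\times n}$ and a vector $\bm{b}\in\mathbb{C}^n$, let the function $f$ be analytic on and inside a closed contour $\mathcal{C}$ enclosing the spectrum of $M$ and of $H_k$, where $H_k$ is the upper Hessenberg matrix generated from the Arnoldi process for $M$ and $\bm{b}$. Then the error of the Arnoldi iteration for $f(M)\bm{b}$ can be expressed as $$f(M)\bm{b}-\operatorname{Arn}_k(f;M,\bm{b})=\left(-\frac{1}{2\pi i}\int_{\mathcal{C}} f(z)\,\frac{\det(H_k)}{\det(H_k-zI)}\,(M-zI)^{-1}M\,\mathrm{d}z\right)\bm{\xi}_0^k .$$
   Context: Arnoldi process: given $M\in\mathbb{C}^{n\times n}$, $\bm{b}\in\mathbb{C}^n$ and an iteration number $k$, set $\bm{q}_1=\bm{b}/\|\bm{b}\|$ (Euclidean norm; so $\bm{b}\neq\bm{0}$). For $j=1,2,\dots,k$: start with $\bm{w}=M\bm{q}_j$; for $i=1,\dots,j$ successively put $h_{i,j}=\bm{q}_i^*\bm{w}$ and replace $\bm{w}$ by $\bm{w}-h_{i,j}\bm{q}_i$; then put $h_{j+1,j}=\|\bm{w}\|$, stop if $h_{j+1,j}=0$, and otherwise put $\bm{q}_{j+1}=\bm{w}/h_{j+1,j}$. It is understood that the process does not stop before step $k$. Then $Q_k=[\bm{q}_1,\dots,\bm{q}_k]\in\mathbb{C}^{n\times k}$ has orthonormal columns forming a basis of the Krylov space $\operatorname{span}\{\bm{b},M\bm{b},\dots,M^{k-1}\bm{b}\}$, the matrix $H_k=[h_{i,j}]\in\mathbb{C}^{k\times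 k}$ is upper Hessenberg with $H_k=Q_k^*MQ_k$, and $MQ_k=Q_kH_k+h_{k+1,k}\bm{q}_{k+1}\bm{e}_k^T$, where $\bm{e}_j$ denotes the $j$-th canonical basis vector of $\mathbb{C}^k$. The $k$-th Arnoldi approximation to $f(M)\bm{b}$ is $\operatorname{Arn}_k(f;M,\bm{b}):=Q_kf(H_k)Q_k^*\bm{b}=\|\bm{b}\|Q_kf(H_k)\bm{e}_1$. For a matrix $A$ whose spectrum is enclosed by $\mathcal{C}$, the matrix function is $f(A)=-\frac{1}{2\pi i}\int_{\mathcal{C}}f(z)(A-zI)^{-1}\,\mathrm{d}z$, with $\mathcal{C}$ traversed in the positive direction. For a shift $z$, $\bm{\xi}_z^k:=(M-zI)^{-1}\bm{b}-Q_k(H_k-zI)^{-1}\|\bm{b}\|\bm{e}_1$ is the error of the $k$-th approximation by the Full Orthogonalization Method (zero initial guess) to the solution of $(M-zI)\bm{x}=\bm{b}$; thus $\bm{\xi}_0^k=M^{-1}\bm{b}-Q_kH_k^{-1}\|\bm{b}\|\bm{e}_1$ is the corresponding error for $M\bm{x}=\bm{b}$. *)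

theory Defs
  imports
    "HOL-Complex_Analysis.Complex_Analysis"
    "Jordan_Normal_Form.Gauss_Jordan_Elimination"
    "Jordan_Normal_Form.Schur_Decomposition"
    "Jordan_Normal_Form.Spectral_Radius"
begin

definition cvec_norm :: "complex vec \<Rightarrow> real" where
  "cvec_norm v = L2_set (\<lambda>i. cmod (vec_index v i)) {..<dim_vec v}"

text \<open>Only meaningful for invertible square matrices; elsewhere the value is unspecified.\<close>
definition mat_inv :: "complex mat \<Rightarrow> complex mat" where
  "mat_inv A = the (mat_inverse A)"

text \<open>Here \<open>w \<bullet>c q\<close> conjugates its second argument, i.e. it is \<open>q\<^sup>* w\<close>.
  The coefficient is taken from the current, already partly orthogonalised \<open>w\<close>
  (modified Gram-Schmidt), and the \<open>q\<close>s are processed from the head of the list.\<close>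
primrec arnoldi_orth :: "complex vec list \<Rightarrow> complex vec \<Rightarrow> complex vec" where
  "arnoldi_orth [] w = w"
| "arnoldi_orth (q # qs) w = arnoldi_orth qs (w - (w \<bullet>c q) \<cdot>\<^sub>v q)"

text \<open>\<open>arnoldi_vecs M b k\<close> is the list of \<open>q\<^sub>1, \<dots>, q\<^sub>k\<close>. If the process has to stop
  early, the list is padded with zero vectors (division by zero yields zero).\<close>
primrec arnoldi_vecs :: "complex mat \<Rightarrow> complex vec \<Rightarrow> nat \<Rightarrow> complex vec list" where
  "arnoldi_vecs M b 0 = []"
| "arnoldi_vecs M b (Suc j) =
    (let qs = arnoldi_vecs M b j;
         w = (if j = 0 then b else arnoldi_orth qs (M *\<^sub>v last qs))
     in qs @ [complex_of_real (1 / cvec_norm w) \<cdot>\<^sub>v w])"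

text \<open>The coefficients \<open>h\<^sub>i\<^sub>,\<^sub>j\<close>, with indices \<open>i, j\<close> starting at 1.\<close>
definition arnoldi_h :: "complex mat \<Rightarrow> complex vec \<Rightarrow> nat \<Rightarrow> nat \<Rightarrow> complex" where
  "arnoldi_h M b i j =
    (let qs = arnoldi_vecs M b j;
         w = M *\<^sub>v last qs
     in if i \<le> j then arnoldi_orth (take (i - 1) qs) w \<bullet>c (qs ! (i - 1))
        else if i = j + 1 then complex_of_real (cvec_norm (arnoldi_orth qs w))
        else 0)"

text \<open>The process does not stop before step \<open>k\<close>; stopping at step \<open>k\<close>
  itself, i.e. \<open>h\<^sub>k\<^sub>+\<^sub>1\<^sub>,\<^sub>k = 0\<close>, is allowed.\<close>
definition arnoldi_reaches :: "complex mat \<Rightarrow> complex vec \<Rightarrow> nat \<Rightarrow> bool" where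
  "arnoldi_reaches M b k \<longleftrightarrow> (\<forall>j. 1 \<le> j \<and> j < k \<longrightarrow> arnoldi_h M b (j + 1) j \<noteq> 0)"

definition arnoldi_Q :: "complex mat \<Rightarrow> complex vec \<Rightarrow> nat \<Rightarrow> complex mat" where
  "arnoldi_Q M b k = mat_of_cols (dim_vec b) (arnoldi_vecs M b k)"

definition arnoldi_H :: "complex mat \<Rightarrow> complex vec \<Rightarrow> nat \<Rightarrow> complex mat" where
  "arnoldi_H M b k = Matrix.mat k k (\<lambda>(i, j). arnoldi_h M b (i + 1) (j + 1))"

text \<open>The shifted matrix \<open>A - z I\<close> for square \<open>A\<close>.\<close>
definition shift_mat :: "complex mat \<Rightarrow> complex \<Rightarrow> complex mat" where
  "shift_mat A z = A - z \<cdot>\<^sub>m 1\<^sub>m (dim_row A)"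

text \<open>Entrywise contour integral of an \<open>nr \<times> nc\<close> matrix-valued function.\<close>
definition mat_contour_integral ::
  "nat \<Rightarrow> nat \<Rightarrow> (real \<Rightarrow> complex) \<Rightarrow> (complex \<Rightarrow> complex mat) \<Rightarrow> complex mat" where
  "mat_contour_integral nr nc \<gamma> F =
    Matrix.mat nr nc (\<lambda>(i, j). contour_integral \<gamma> (\<lambda>z. F z $$ (i, j)))"

text \<open>\<open>f(A)\<close> by the Cauchy integral over \<open>\<gamma>\<close>; intended for \<open>\<gamma>\<close> enclosing the spectrum of
  \<open>A\<close> in the positive direction. The minus sign comes from using \<open>A - z I\<close> instead of
  \<open>z I - A\<close>.\<close>
definition mat_fun :: "(real \<Rightarrow> complex) \<Rightarrow> (complex \<Rightarrow> complex) \<Rightarrow> complex mat \<Rightarrow> complex mat" where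
  "mat_fun \<gamma> f A =
    (- 1 / (2 * complex_of_real pi * \<i>)) \<cdot>\<^sub>m
      mat_contour_integral (dim_row A) (dim_row A) \<gamma> (\<lambda>z. f z \<cdot>\<^sub>m mat_inv (shift_mat A z))"

definition arnoldi_approx ::
  "nat \<Rightarrow> (real \<Rightarrow> complex) \<Rightarrow> (complex \<Rightarrow> complex) \<Rightarrow> complex mat \<Rightarrow> complex vec \<Rightarrow> complex vec" where
  "arnoldi_approx k \<gamma> f M b =
    arnoldi_Q M b k *\<^sub>v (mat_fun \<gamma> f (arnoldi_H M b k) *\<^sub>v (mat_adjoint (arnoldi_Q M b k) *\<^sub>v b))"

text \<open>The error \<open>\<xi>\<^sub>z\<^sup>k\<close> of the \<open>k\<close>-th FOM approximation (zero initial guess) for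
  \<open>(M - z I) x = b\<close>. The canonical vector \<open>e\<^sub>1\<close> is \<open>unit_vec k 0\<close>.\<close>
definition fom_error :: "complex mat \<Rightarrow> complex vec \<Rightarrow> nat \<Rightarrow> complex \<Rightarrow> complex vec" where
  "fom_error M b k z =
    mat_inv (shift_mat M z) *\<^sub>v b
    - arnoldi_Q M b k *\<^sub>v
        (mat_inv (shift_mat (arnoldi_H M b k) z) *\<^sub>v
          (complex_of_real (cvec_norm b) \<cdot>\<^sub>v unit_vec k 0))"

text \<open>\<open>\<gamma>\<close> winds exactly once, in the positive direction, around every point of \<open>S\<close>.
  The winding number is meaningless on the path itself; membership in \<open>inside\<close> excludes
  this. The path need not be simple.\<close>
definition encloses_positively :: "(real \<Rightarrow> complex) \<Rightarrow> complex set \<Rightarrow> bool" where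
  "encloses_positively \<gamma> S \<longleftrightarrow>
    (\<forall>z\<in>S. z \<in> inside (path_image \<gamma>) \<and> winding_number \<gamma> z = 1)"

end

theory Submission
  imports Defs
begin

text \<open>
  By the Arnoldi relation \<open>M Q = Q H + w e\<^sub>k\<^sup>T\<close>, the residual of the FOM approximation for
  \<open>(M - z I) x = b\<close> is \<open>- y w\<close>, where \<open>y\<close> is the last entry of
  \<open>(H - z I)\<^sup>-\<^sup>1 \<parallel>b\<parallel> e\<^sub>1\<close>. By Cramer's rule \<open>y\<close> is \<open>\<parallel>b\<parallel>\<close> times a cofactor of \<open>H - z I\<close> divided by
  \<open>det (H - z I)\<close>, and because \<open>H\<close> is upper Hessenberg this cofactor does not depend on \<open>z\<close>.
  Comparing with \<open>z = 0\<close> gives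
  \<open>\<xi>\<^sub>z = det H / det (H - z I) (M - z I)\<^sup>-\<^sup>1 M \<xi>\<^sub>0\<close> on the contour, and the theorem is the
  integral of this identity against \<open>f\<close>.
\<close>

unbundle no vec_syntax
no_notation fps_nth (infixl "$" 75)
no_notation fls_nth (infixl "$$" 75)

subsection \<open>The Arnoldi relation\<close>

lemma length_arnoldi_vecs [simp]: "length (arnoldi_vecs M b k) = k"
  by (induction k) (auto simp: Let_def)

text \<open>The process only appends vectors, so an earlier list is a prefix of every later one.
  This lets all coefficients be rewritten in terms of the single list of length
  \<open>k\<close>.\<close>

lemma take_arnoldi_vecs: "j \<le> k \<Longrightarrow> take j (arnoldi_vecs M b k) = arnoldi_vecs M b j"
proof (induction k)
  case (Suc k)
  then show ?case
    by (cases "j = Suc k") (auto simp: Let_def)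
qed simp

lemma nth_arnoldi_vecs: "i < j \<Longrightarrow> j \<le> k \<Longrightarrow> arnoldi_vecs M b j ! i = arnoldi_vecs M b k ! i"
  using take_arnoldi_vecs[of j k M b] by (metis nth_take)

lemma arnoldi_orth_carrier:
  "set qs \<subseteq> carrier_vec n \<Longrightarrow> w \<in> carrier_vec n \<Longrightarrow> arnoldi_orth qs w \<in> carrier_vec n"
  by (induction qs arbitrary: w) auto

lemma last_carrier_vec:
  "set qs \<subseteq> carrier_vec n \<Longrightarrow> qs \<noteq> [] \<Longrightarrow> last qs \<in> carrier_vec n"
  using last_in_set by blast

lemma arnoldi_vecs_carrier:
  assumes "M \<in> carrier_mat n n" "b \<in> carrier_vec n"
  shows "set (arnoldi_vecs M b k) \<subseteq> carrier_vec n"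
proof (induction k)
  case (Suc k)
  have "arnoldi_orth (arnoldi_vecs M b k) (M *\<^sub>v last (arnoldi_vecs M b k)) \<in> carrier_vec n" if "k \<noteq> 0"
    using that assms Suc.IH
    by (intro arnoldi_orth_carrier mult_mat_vec_carrier last_carrier_vec)
       (auto simp flip: length_0_conv)
  then show ?case using Suc.IH assms by (auto simp: Let_def)
qed simp

lemma nth_arnoldi_vecs_carrier:
  assumes "M \<in> carrier_mat n n" "b \<in> carrier_vec n" "i < k"
  shows "arnoldi_vecs M b k ! i \<in> carrier_vec n"
  using arnoldi_vecs_carrier[OF assms(1,2), of k] assms(3) by (auto simp: set_conv_nth)

text \<open>The subtractions telescope. The \<open>l\<close>-th coefficient is taken against the
  partly orthogonalised vector \<open>arnoldi_orth (take l qs) w\<close>, exactly as in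
  \<open>arnoldi_h\<close>.\<close>

lemma arnoldi_orth_expand:
  assumes "set qs \<subseteq> carrier_vec n" "w \<in> carrier_vec n" "i < n"
  shows "w $ i = (\<Sum>l<length qs. (arnoldi_orth (take l qs) w \<bullet>c qs ! l) * (qs ! l) $ i)
    + arnoldi_orth qs w $ i"
  using assms
proof (induction qs arbitrary: w)
  case (Cons q qs)
  have q: "q \<in> carrier_vec n" "set qs \<subseteq> carrier_vec n" using Cons.prems by auto
  define w' where "w' = w - (w \<bullet>c q) \<cdot>\<^sub>v q"
  have "w' \<in> carrier_vec n" using Cons.prems q by (auto simp: w'_def)
  from Cons.IH[OF q(2) this \<open>i < n\<close>] Cons.prems q show ?case
    by (simp add: sum.lessThan_Suc_shift w'_def algebra_simps del: sum.lessThan_Suc)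
qed simp

section \<open>Orthogonality produced by the Gram-Schmidt sweep\<close>

lemma minus_smult_cscalar_prod:
  fixes w q u :: "complex vec"
  assumes "w \<in> carrier_vec n" "q \<in> carrier_vec n" "u \<in> carrier_vec n"
  shows "(w - c \<cdot>\<^sub>v q) \<bullet>c u = w \<bullet>c u - c * (q \<bullet>c u)"
  using assms by (simp add: minus_scalar_prod_distrib[of _ n])

lemma arnoldi_orth_cscalar_prod:
  assumes "set qs \<subseteq> carrier_vec n" "w \<in> carrier_vec n" "u \<in> carrier_vec n"
    and "\<forall>q\<in>set qs. q \<bullet>c u = 0"
  shows "arnoldi_orth qs w \<bullet>c u = w \<bullet>c u"
  using assms
proof (induction qs arbitrary: w)
  case (Cons q qs)
  then show ?case
    by (simp add: minus_smult_cscalar_prod[of _ n])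
qed simp

text \<open>Phrased by positions rather than by membership, so that repeated vectors are
  excluded.\<close>

definition orthonormal :: "complex vec list \<Rightarrow> bool" where
  "orthonormal qs \<longleftrightarrow> (\<forall>i<length qs. \<forall>j<length qs. qs ! i \<bullet>c qs ! j = (if i = j then 1 else 0))"

lemma cscalar_prod_commute_cnj:
  fixes u v :: "complex vec"
  assumes "u \<in> carrier_vec n" "v \<in> carrier_vec n"
  shows "u \<bullet>c v = cnj (v \<bullet>c u)"
  using assms by (auto simp: scalar_prod_def intro!: sum.cong)

lemma orthonormal_Cons:
  "orthonormal (q # qs) \<Longrightarrow> orthonormal qs \<and> q \<bullet>c q = 1 \<and> (\<forall>v\<in>set qs. q \<bullet>c v = 0 \<and> v \<bullet>c q = 0)"
  unfolding orthonormal_def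
  by (simp add: All_less_Suc2 all_set_conv_all_nth)

lemma orthonormal_snoc:
  assumes "orthonormal qs" "set qs \<subseteq> carrier_vec n" "v \<in> carrier_vec n" "v \<bullet>c v = 1"
    and "\<forall>q\<in>set qs. v \<bullet>c q = 0"
  shows "orthonormal (qs @ [v])"
proof -
  have "q \<bullet>c v = 0" if "q \<in> set qs" for q
    using cscalar_prod_commute_cnj[of q n v] assms that by auto
  then show ?thesis
    using assms unfolding orthonormal_def by (auto simp: nth_append less_Suc_eq)
qed

text \<open>The component along a unit vector \<open>u\<close> vanishes when the sweep reaches
  \<open>u\<close>, and later subtractions, being multiples of vectors orthogonal to
  \<open>u\<close>, do not bring it back.\<close>

lemma arnoldi_orth_orthogonal:
  assumes "set qs \<subseteq> carrier_vec n" "w \<in> carrier_vec n" "orthonormal qs" "u \<in> set qs"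
  shows "arnoldi_orth qs w \<bullet>c u = 0"
  using assms
proof (induction qs arbitrary: w)
  case (Cons q qs)
  note o = orthonormal_Cons[OF Cons.prems(3)]
  have c: "q \<in> carrier_vec n" "set qs \<subseteq> carrier_vec n" "w - (w \<bullet>c q) \<cdot>\<^sub>v q \<in> carrier_vec n"
    using Cons.prems by auto
  show ?case
  proof (cases "u \<in> set qs")
    case False
    then have "u = q" using Cons.prems by simp
    then show ?thesis
      using o c Cons.prems(2)
      by (simp add: arnoldi_orth_cscalar_prod[of _ n] minus_smult_cscalar_prod[of _ n])
  qed (use Cons.IH c o in auto)
qed simp

lemma cvec_norm_eq_0: "v \<in> carrier_vec n \<Longrightarrow> cvec_norm v = 0 \<longleftrightarrow> v = 0\<^sub>v n"
  by (auto simp: cvec_norm_def L2_set_eq_0_iff)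

lemma cscalar_prod_self: "v \<bullet>c v = complex_of_real (cvec_norm v ^ 2)"
  by (auto simp: cvec_norm_def L2_set_def scalar_prod_def sum_nonneg complex_norm_square
        atLeast0LessThan intro!: sum.cong simp del: of_real_power)

lemma normalize_cscalar_prod:
  assumes "v \<in> carrier_vec n" "cvec_norm v \<noteq> 0"
  shows "(complex_of_real (1 / cvec_norm v) \<cdot>\<^sub>v v) \<bullet>c (complex_of_real (1 / cvec_norm v) \<cdot>\<^sub>v v) = 1"
  using assms
  by (simp add: conjugate_smult_vec cscalar_prod_self power2_eq_square)

text \<open>The vector normalised in step \<open>k\<close>, namely \<open>h\<^sub>k\<^sub>+\<^sub>1\<^sub>,\<^sub>k q\<^sub>k\<^sub>+\<^sub>1\<close>, but meaningful also when the
  process stops there.\<close>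
definition arnoldi_rest :: "complex mat \<Rightarrow> complex vec \<Rightarrow> nat \<Rightarrow> complex vec" where
  "arnoldi_rest M b k =
    (if k = 0 then b else arnoldi_orth (arnoldi_vecs M b k) (M *\<^sub>v last (arnoldi_vecs M b k)))"

lemma arnoldi_vecs_Suc:
  "arnoldi_vecs M b (Suc k) = arnoldi_vecs M b k
    @ [complex_of_real (1 / cvec_norm (arnoldi_rest M b k)) \<cdot>\<^sub>v arnoldi_rest M b k]"
  by (simp add: arnoldi_rest_def Let_def)

lemma arnoldi_h_subdiagonal:
  "j \<noteq> 0 \<Longrightarrow> arnoldi_h M b (Suc j) j = complex_of_real (cvec_norm (arnoldi_rest M b j))"
  by (simp add: arnoldi_h_def arnoldi_rest_def Let_def)

lemma arnoldi_rest_carrier: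
  assumes "M \<in> carrier_mat n n" "b \<in> carrier_vec n"
  shows "arnoldi_rest M b k \<in> carrier_vec n"
  using assms arnoldi_vecs_carrier[OF assms, of k] unfolding arnoldi_rest_def
  by (auto intro!: arnoldi_orth_carrier mult_mat_vec_carrier[of M n n] last_carrier_vec
      simp flip: length_0_conv)

section \<open>The Arnoldi process running up to step \<open>k\<close> without stopping\<close>

context
  fixes M :: "complex mat" and b :: "complex vec" and n k :: nat
  assumes M: "M \<in> carrier_mat n n" and b: "b \<in> carrier_vec n" "b \<noteq> 0\<^sub>v n"
    and reaches: "arnoldi_reaches M b k"
begin

text \<open>For \<open>j = 0\<close> this is \<open>b\<close> being nonzero; for larger
  \<open>j\<close> the norm is the subdiagonal coefficient that \<open>arnoldi_reaches\<close> keeps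
  away from zero. Hence none of the first \<open>k\<close> vectors is zero padding.\<close>

lemma cvec_norm_arnoldi_rest: "j < k \<Longrightarrow> cvec_norm (arnoldi_rest M b j) \<noteq> 0"
proof (cases "j = 0")
  case True
  then show ?thesis using b cvec_norm_eq_0 by (simp add: arnoldi_rest_def)
next
  case False
  assume "j < k"
  then have "arnoldi_h M b (j + 1) j \<noteq> 0"
    using reaches False by (auto simp: arnoldi_reaches_def)
  then show ?thesis using False by (simp add: arnoldi_h_subdiagonal)
qed

lemma orthonormal_arnoldi_vecs: "j \<le> k \<Longrightarrow> orthonormal (arnoldi_vecs M b j)"
proof (induction j)
  case 0
  then show ?case by (simp add: orthonormal_def)
next
  case (Suc j)
  let ?qs = "arnoldi_vecs M b j" and ?w = "arnoldi_rest M b j"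
  have w: "?w \<in> carrier_vec n" and qs: "set ?qs \<subseteq> carrier_vec n"
    using arnoldi_rest_carrier arnoldi_vecs_carrier M b by auto
  have "?w \<bullet>c q = 0" if "q \<in> set ?qs" for q
  proof -
    \<comment> \<open>For \<open>j = 0\<close> the new vector comes from \<open>b\<close>, but then
      there is no earlier vector to be orthogonal to.\<close>
    have j: "j \<noteq> 0" "?qs \<noteq> []" using that by (auto intro: ccontr)
    have "M *\<^sub>v last ?qs \<in> carrier_vec n"
      using last_carrier_vec[OF qs j(2)] M by auto
    then show ?thesis
      using arnoldi_orth_orthogonal[OF qs _ _ that] Suc j by (simp add: arnoldi_rest_def)
  qed
  moreover have "q \<in> carrier_vec n" if "q \<in> set ?qs" for q using that qs by auto
  ultimately show ?case
    unfolding arnoldi_vecs_Suc using Suc w qs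
    by (intro orthonormal_snoc[of _ n] normalize_cscalar_prod[of _ n] cvec_norm_arnoldi_rest)
      (auto)
qed

text \<open>Column \<open>j\<close> of \<open>M Q = Q H + w e_k^T\<close>, read entrywise. The
  remainder of the sweep is the subdiagonal coefficient times the next vector, except in the last
  column, where no next vector belongs to \<open>Q\<close>.\<close>

lemma arnoldi_relation:
  assumes "i < n" "j < k"
  shows "(M *\<^sub>v (arnoldi_vecs M b k ! j)) $ i =
    (\<Sum>l<k. arnoldi_vecs M b k ! l $ i * arnoldi_h M b (l + 1) (j + 1))
    + (if j + 1 = k then arnoldi_rest M b k $ i else 0)"
proof -
  let ?q = "\<lambda>l. arnoldi_vecs M b k ! l" and ?qs = "arnoldi_vecs M b (Suc j)"
  let ?h = "\<lambda>l. arnoldi_h M b (l + 1) (j + 1)"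
  have qs: "set ?qs \<subseteq> carrier_vec n" using arnoldi_vecs_carrier M b by blast
  have last: "last ?qs = ?q j"
    using assms nth_arnoldi_vecs[of j "Suc j" k M b] by (simp add: last_conv_nth flip: length_0_conv del: arnoldi_vecs.simps)
  have "?qs \<noteq> []" by (simp flip: length_0_conv del: arnoldi_vecs.simps)
  then have w: "M *\<^sub>v last ?qs \<in> carrier_vec n"
    using last_carrier_vec[OF qs] M by auto
  have "(M *\<^sub>v ?q j) $ i =
      (\<Sum>l<Suc j. ?q l $ i * ?h l) + arnoldi_rest M b (Suc j) $ i"
    using arnoldi_orth_expand[OF qs w \<open>i < n\<close>] assms
    by (simp add: last arnoldi_rest_def arnoldi_h_def Let_def nth_arnoldi_vecs[of _ "Suc j" k] mult.commute
         del: arnoldi_vecs.simps sum.lessThan_Suc)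
  also have "\<dots> = (\<Sum>l<k. ?q l $ i * ?h l) + (if j + 1 = k then arnoldi_rest M b k $ i else 0)"
  proof (cases "j + 1 = k")
    case False
    then have j: "Suc j < k" using assms by simp
    have "?q (Suc j) = arnoldi_vecs M b (Suc (Suc j)) ! Suc j"
      using j nth_arnoldi_vecs[of "Suc j" "Suc (Suc j)" k M b] by simp
    also have "\<dots> = complex_of_real (1 / cvec_norm (arnoldi_rest M b (Suc j))) \<cdot>\<^sub>v arnoldi_rest M b (Suc j)"
      by (subst arnoldi_vecs_Suc) (simp add: nth_append del: arnoldi_vecs.simps)
    \<comment> \<open>Normalisation is undone by the subdiagonal entry, so the remainder becomes the
      summand \<open>l = Suc j\<close>.\<close>
    finally have "?q (Suc j) $ i * ?h (Suc j) = arnoldi_rest M b (Suc j) $ i"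
      using cvec_norm_arnoldi_rest[OF j] arnoldi_rest_carrier[OF M b(1), of "Suc j"] \<open>i < n\<close>
      by (simp add: arnoldi_h_subdiagonal)
    \<comment> \<open>The summands from \<open>l = j + 2\<close> on vanish because
      \<open>arnoldi_h\<close> is zero below the subdiagonal.\<close>
    moreover have "(\<Sum>l<k. ?q l $ i * ?h l) = (\<Sum>l<Suc (Suc j). ?q l $ i * ?h l)"
      using j by (intro sum.mono_neutral_right) (auto simp: arnoldi_h_def Let_def)
    ultimately show ?thesis using False by simp
  qed simp
  finally show ?thesis .
qed

end

subsection \<open>The error of the shifted systems\<close>

lemma arnoldi_H_carrier [simp]: "arnoldi_H M b k \<in> carrier_mat k k"
  by (simp add: arnoldi_H_def)

lemma arnoldi_Q_carrier: "b \<in> carrier_vec n \<Longrightarrow> arnoldi_Q M b k \<in> carrier_mat n k"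
  by (auto simp: arnoldi_Q_def mat_of_cols_def)

lemma shift_mat_carrier [simp]: "A \<in> carrier_mat n n \<Longrightarrow> shift_mat A z \<in> carrier_mat n n"
  by (auto simp: shift_mat_def)

lemma shift_mat_index:
  "A \<in> carrier_mat n n \<Longrightarrow> i < n \<Longrightarrow> j < n \<Longrightarrow>
    shift_mat A z $$ (i, j) = A $$ (i, j) - (if i = j then z else 0)"
  by (auto simp: shift_mat_def)

lemma shift_mat_0 [simp]: "A \<in> carrier_mat n n \<Longrightarrow> shift_mat A 0 = A"
  by (auto simp: shift_mat_def)

lemma shift_mat_mult_vec:
  assumes "A \<in> carrier_mat n n" "v \<in> carrier_vec n"
  shows "shift_mat A z *\<^sub>v v = A *\<^sub>v v - z \<cdot>\<^sub>v v"
proof -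
  have "z \<cdot>\<^sub>m 1\<^sub>m n *\<^sub>v v = z \<cdot>\<^sub>v v"
    using assms by auto
  then show ?thesis
    using assms by (simp add: shift_mat_def minus_mult_distrib_mat_vec[of _ n n])
qed

text \<open>A nonzero determinant makes \<open>mat_inverse\<close> return a \<open>Some\<close>,
  which gives the otherwise unspecified \<open>mat_inv\<close> its meaning.\<close>

lemma mat_inv_det:
  assumes A: "A \<in> carrier_mat n n" and "Determinant.det A \<noteq> 0"
  shows "mat_inv A \<in> carrier_mat n n" "A * mat_inv A = 1\<^sub>m n" "mat_inv A * A = 1\<^sub>m n"
proof -
  have "A \<in> Units (ring_mat TYPE(complex) n ())"
    using det_non_zero_imp_unit[OF assms] .
  then obtain B where "mat_inverse A = Some B"
    using mat_inverse(1)[OF A, where b = "()"] by (cases "mat_inverse A") auto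
  with mat_inverse(2)[OF A this]
  show "mat_inv A \<in> carrier_mat n n" "A * mat_inv A = 1\<^sub>m n" "mat_inv A * A = 1\<^sub>m n"
    by (auto simp: mat_inv_def)
qed

lemma mat_inv_mult_vec:
  assumes A: "A \<in> carrier_mat n n" and d: "Determinant.det A \<noteq> 0" and v: "v \<in> carrier_vec n"
  shows "mat_inv A *\<^sub>v (A *\<^sub>v v) = v" "A *\<^sub>v (mat_inv A *\<^sub>v v) = v"
  using assoc_mult_mat_vec[OF A mat_inv_det(1)[OF A d] v]
    assoc_mult_mat_vec[OF mat_inv_det(1)[OF A d] A v] mat_inv_det[OF A d] v
  by auto

lemma mult_mat_vec_index:
  "A \<in> carrier_mat n k \<Longrightarrow> v \<in> carrier_vec k \<Longrightarrow> i < n \<Longrightarrow>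
    (A *\<^sub>v v) $ i = (\<Sum>j<k. A $$ (i, j) * v $ j)"
  by (auto simp: scalar_prod_def atLeast0LessThan)

lemma smult_mat_mult_vec:
  "(A :: complex mat) \<in> carrier_mat n k \<Longrightarrow> v \<in> carrier_vec k \<Longrightarrow>
    (c \<cdot>\<^sub>m A) *\<^sub>v v = c \<cdot>\<^sub>v (A *\<^sub>v v)"
  by (intro eq_vecI) auto

lemma mult_unit_vec_col:
  "(A :: complex mat) \<in> carrier_mat n k \<Longrightarrow> j < k \<Longrightarrow> A *\<^sub>v unit_vec k j = Matrix.col A j"
  by (intro eq_vecI) auto

text \<open>Cramer's rule, from multiplying \<open>adj_mat A * A = det A I\<close> by the inverse.
  It supplies both the cofactor formula for the residual and the holomorphy of the resolvent
  entries.\<close>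

lemma mat_inv_adj_mat:
  assumes A: "A \<in> carrier_mat n n" and d: "Determinant.det A \<noteq> 0"
  shows "mat_inv A = (1 / Determinant.det A) \<cdot>\<^sub>m adj_mat A"
proof -
  note inv = mat_inv_det[OF assms] and adj = adj_mat[OF A]
  have "Determinant.det A \<cdot>\<^sub>m mat_inv A = (adj_mat A * A) * mat_inv A"
    unfolding adj(3) using inv(1) mult_smult_assoc_mat[of "1\<^sub>m n" n n "mat_inv A" n] by simp
  also have "\<dots> = adj_mat A"
    using assoc_mult_mat[OF adj(1) A inv(1)] inv(2) adj(1) by simp
  finally have "adj_mat A = Determinant.det A \<cdot>\<^sub>m mat_inv A" ..
  then show ?thesis using d inv(1) by (intro eq_matI) auto
qed

text \<open>A nonzero kernel vector of the shifted matrix would be an eigenvector of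
  \<open>A\<close> for \<open>z\<close>.\<close>

lemma shift_mat_det_neq_0:
  assumes "A \<in> carrier_mat n n" "z \<notin> spectrum A"
  shows "Determinant.det (shift_mat A z) \<noteq> 0"
proof
  assume "Determinant.det (shift_mat A z) = 0"
  then obtain v where v: "v \<in> carrier_vec n" "v \<noteq> 0\<^sub>v n" "shift_mat A z *\<^sub>v v = 0\<^sub>v n"
    using det_0_iff_vec_prod_zero[OF shift_mat_carrier[OF assms(1), of z]] by auto
  then have "(A *\<^sub>v v - z \<cdot>\<^sub>v v) $ i = 0" if "i < n" for i
    using assms that by (simp add: shift_mat_mult_vec)
  then have "A *\<^sub>v v = z \<cdot>\<^sub>v v"
    using assms v by (intro eq_vecI) auto
  then have "z \<in> spectrum A"
    using assms v by (auto simp: spectrum_def eigenvalue_def eigenvector_def)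
  with assms show False by simp
qed

lemma invertible_mat_det_neq_0:
  fixes A :: "complex mat"
  assumes "A \<in> carrier_mat n n" "invertible_mat A"
  shows "Determinant.det A \<noteq> 0"
proof -
  obtain B where B: "A * B = 1\<^sub>m n" "B * A = 1\<^sub>m (dim_row B)"
    using assms by (auto simp: invertible_mat_def inverts_mat_def)
  \<comment> \<open>\<open>invertible_mat\<close> does not state the size of \<open>B\<close>; it is
    recovered by comparing column counts in both identities.\<close>
  have "B \<in> carrier_mat n n"
    using arg_cong[OF B(1), of dim_col] arg_cong[OF B(2), of dim_col] assms(1)
    by (intro carrier_matI) auto
  with B have "Determinant.det A * Determinant.det B = 1"
    using det_mult[of A n B] assms B by simp
  then show ?thesis by auto
qed

text \<open>Deleting the first row and the last column of an upper Hessenberg matrix leaves an upper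
  triangular matrix whose diagonal consists of the subdiagonal entries, which a shift does not
  touch.\<close>
lemma cofactor_shift_mat_hessenberg:
  assumes A: "A \<in> carrier_mat k k" and "1 \<le> k"
    and hess: "\<And>i j. i < k \<Longrightarrow> j + 1 < i \<Longrightarrow> A $$ (i, j) = 0"
  shows "cofactor (shift_mat A z) 0 (k - 1) = cofactor A 0 (k - 1)"
proof -
  let ?D = "\<lambda>z. mat_delete (shift_mat A z) 0 (k - 1)"
  \<comment> \<open>Deleting row 0 moves every row up by one, so the shift sits at
    \<open>Suc i = j\<close>, strictly above the diagonal of the minor, while entries below the
    diagonal come from the zero part of \<open>A\<close>.\<close>
  have idx: "?D z $$ (i, j) = A $$ (Suc i, j) - (if Suc i = j then z else 0)"
    if "i < k - 1" "j < k - 1" for i j z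
    using that A carrier_matD[OF shift_mat_carrier[OF A, of z]]
    by (auto simp: mat_delete_def shift_mat_index)
  have D: "?D z \<in> carrier_mat (k - 1) (k - 1)" for z
    using A by (intro mat_delete_carrier shift_mat_carrier)
  have "upper_triangular (?D z)" for z
    using hess D[of z] idx by (intro upper_triangularI) auto
  then have "Determinant.det (?D z) = prod_list (diag_mat (?D z))" for z
    using D det_upper_triangular by blast
  moreover have "diag_mat (?D z) = diag_mat (?D 0)"
    using carrier_matD[OF D[of z]] carrier_matD[OF D[of 0]] idx
    by (auto simp: diag_mat_def simp del: mat_delete_dim)
  ultimately have "Determinant.det (?D z) = Determinant.det (?D 0)" by presburger
  then show ?thesis
    using A by (simp add: cofactor_def)
qed

section \<open>Residuals and errors of the shifted FOM systems\<close>

context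
  fixes M :: "complex mat" and b :: "complex vec" and n k :: nat
  assumes M: "M \<in> carrier_mat n n" and b: "b \<in> carrier_vec n" "b \<noteq> 0\<^sub>v n"
    and reaches: "arnoldi_reaches M b k" and k: "1 \<le> k"
begin

lemma col_arnoldi_Q: "j < k \<Longrightarrow> Matrix.col (arnoldi_Q M b k) j = arnoldi_vecs M b k ! j"
  using nth_arnoldi_vecs_carrier[OF M b(1), of j k] b(1)
  by (auto simp: arnoldi_Q_def mat_of_cols_def intro!: eq_vecI)

text \<open>The rank-one term \<open>w e_k^T\<close> of the Arnoldi relation picks out the last
  entry of \<open>y\<close>, which has index \<open>k - 1\<close>.\<close>

lemma arnoldi_relation_mat:
  assumes "y \<in> carrier_vec k"
  shows "M *\<^sub>v (arnoldi_Q M b k *\<^sub>v y) =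
    arnoldi_Q M b k *\<^sub>v (arnoldi_H M b k *\<^sub>v y) + y $ (k - 1) \<cdot>\<^sub>v arnoldi_rest M b k"
    (is "M *\<^sub>v (?Q *\<^sub>v y) = ?Q *\<^sub>v (?H *\<^sub>v y) + _ \<cdot>\<^sub>v ?w")
proof -
  have Q: "?Q \<in> carrier_mat n k" and w: "?w \<in> carrier_vec n" and H: "?H \<in> carrier_mat k k"
    using arnoldi_Q_carrier arnoldi_rest_carrier M b by auto
  have MQ: "(M * ?Q) $$ (i, j) = (?Q * ?H) $$ (i, j) + (if j = k - 1 then ?w $ i else 0)"
    if "i < n" "j < k" for i j
  proof -
    have "(M * ?Q) $$ (i, j) = (M *\<^sub>v (arnoldi_vecs M b k ! j)) $ i"
      using that M Q by (simp add: col_arnoldi_Q)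
    also have "\<dots> = (\<Sum>l<k. arnoldi_vecs M b k ! l $ i * arnoldi_h M b (l + 1) (j + 1))
      + (if j = k - 1 then ?w $ i else 0)"
      using arnoldi_relation[OF M b reaches that] k by auto
    also have "(\<Sum>l<k. arnoldi_vecs M b k ! l $ i * arnoldi_h M b (l + 1) (j + 1)) = (?Q * ?H) $$ (i, j)"
      using that Q H b
      by (auto simp: scalar_prod_def atLeast0LessThan arnoldi_Q_def arnoldi_H_def mat_of_cols_def)
    finally show ?thesis .
  qed
  have "(M * ?Q) *\<^sub>v y = (?Q * ?H) *\<^sub>v y + y $ (k - 1) \<cdot>\<^sub>v ?w"
  proof (rule eq_vecI)
    fix i assume "i < dim_vec ((?Q * ?H) *\<^sub>v y + y $ (k - 1) \<cdot>\<^sub>v ?w)"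
    then have i: "i < n" using w by simp
    have "((M * ?Q) *\<^sub>v y) $ i = (\<Sum>j<k. (M * ?Q) $$ (i, j) * y $ j)"
      using i M Q assms by (intro mult_mat_vec_index) auto
    also have "\<dots> = (\<Sum>j<k. (?Q * ?H) $$ (i, j) * y $ j + (if j = k - 1 then ?w $ i * y $ j else 0))"
      using MQ i by (intro sum.cong) (auto simp: distrib_right)
    also have "\<dots> = (\<Sum>j<k. (?Q * ?H) $$ (i, j) * y $ j) + ?w $ i * y $ (k - 1)"
      using k by (simp add: sum.distrib)
    also have "(\<Sum>j<k. (?Q * ?H) $$ (i, j) * y $ j) = ((?Q * ?H) *\<^sub>v y) $ i"
      using i H Q assms by (intro mult_mat_vec_index[symmetric]) auto
    finally show "((M * ?Q) *\<^sub>v y) $ i = ((?Q * ?H) *\<^sub>v y + y $ (k - 1) \<cdot>\<^sub>v ?w) $ i"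
      using i w Q by (simp del: index_mult_mat_vec)
  qed (use M Q w in auto)
  then show ?thesis using M Q H assms by simp
qed

lemma smult_first_arnoldi_vec:
  "complex_of_real (cvec_norm b) \<cdot>\<^sub>v arnoldi_vecs M b k ! 0 = b"
proof -
  have "arnoldi_vecs M b 1 ! 0 = complex_of_real (1 / cvec_norm b) \<cdot>\<^sub>v b"
    by (simp add: Let_def)
  then have "arnoldi_vecs M b k ! 0 = complex_of_real (1 / cvec_norm b) \<cdot>\<^sub>v b"
    using k nth_arnoldi_vecs[of 0 1 k M b] by simp
  then show ?thesis
    using b cvec_norm_eq_0[of b n] by (simp add: smult_smult_assoc)
qed

lemma arnoldi_Q_unit_vec:
  "arnoldi_Q M b k *\<^sub>v (complex_of_real (cvec_norm b) \<cdot>\<^sub>v unit_vec k 0) = b"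
proof -
  have Q: "arnoldi_Q M b k \<in> carrier_mat n k" using arnoldi_Q_carrier b by auto
  have "arnoldi_Q M b k *\<^sub>v (complex_of_real (cvec_norm b) \<cdot>\<^sub>v unit_vec k 0)
      = complex_of_real (cvec_norm b) \<cdot>\<^sub>v (arnoldi_Q M b k *\<^sub>v unit_vec k 0)"
    using Q by (intro mult_mat_vec) auto
  also have "arnoldi_Q M b k *\<^sub>v unit_vec k 0 = arnoldi_vecs M b k ! 0"
    using col_arnoldi_Q[of 0] Q k by (simp add: mult_unit_vec_col)
  finally show ?thesis
    by (simp add: smult_first_arnoldi_vec)
qed

text \<open>Since \<open>b\<close> is a multiple of the first Arnoldi vector, orthonormality leaves
  only the first coordinate. This matches \<open>mat_adjoint Q *\<^sub>v b\<close> in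
  \<open>arnoldi_approx\<close> with the right-hand side used in \<open>fom_error\<close>.\<close>

lemma adjoint_arnoldi_Q_mult_b:
  "mat_adjoint (arnoldi_Q M b k) *\<^sub>v b = complex_of_real (cvec_norm b) \<cdot>\<^sub>v unit_vec k 0"
proof (rule eq_vecI)
  have Q: "arnoldi_Q M b k \<in> carrier_mat n k" using arnoldi_Q_carrier b by auto
  let ?q = "\<lambda>i. arnoldi_vecs M b k ! i"
  have c: "?q i \<in> carrier_vec n" if "i < k" for i
    using that nth_arnoldi_vecs_carrier M b(1) by blast
  show "dim_vec (mat_adjoint (arnoldi_Q M b k) *\<^sub>v b)
      = dim_vec (complex_of_real (cvec_norm b) \<cdot>\<^sub>v unit_vec k 0)"
    using Q by (simp add: mat_adjoint_def)
  fix i assume "i < dim_vec (complex_of_real (cvec_norm b) \<cdot>\<^sub>v unit_vec k 0)"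
  then have i: "i < k" by simp
  have "(mat_adjoint (arnoldi_Q M b k) *\<^sub>v b) $ i = conjugate (?q i) \<bullet> b"
    using i Q c col_arnoldi_Q by (simp add: mat_adjoint_def)
  also have "\<dots> = b \<bullet>c ?q i"
    using i c b by (intro comm_scalar_prod) auto
  also have "\<dots> = complex_of_real (cvec_norm b) * (?q 0 \<bullet>c ?q i)"
    using i c k by (subst smult_first_arnoldi_vec[symmetric]) (simp add: smult_scalar_prod_distrib[of _ n])
  also have "?q 0 \<bullet>c ?q i = (if i = 0 then 1 else 0)"
    using orthonormal_arnoldi_vecs[OF M b reaches, of k] i k by (auto simp: orthonormal_def)
  finally show "(mat_adjoint (arnoldi_Q M b k) *\<^sub>v b) $ i
      = (complex_of_real (cvec_norm b) \<cdot>\<^sub>v unit_vec k 0) $ i"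
    using i by simp
qed

lemma fom_error_carrier:
  assumes "Determinant.det (shift_mat M z) \<noteq> 0" "Determinant.det (shift_mat (arnoldi_H M b k) z) \<noteq> 0"
  shows "fom_error M b k z \<in> carrier_vec n"
  unfolding fom_error_def
  using mat_inv_det(1)[OF shift_mat_carrier[OF M] assms(1)]
    mat_inv_det(1)[OF shift_mat_carrier[OF arnoldi_H_carrier] assms(2)]
    arnoldi_Q_carrier[OF b(1), of M k] b by simp

text \<open>All residuals are collinear: only the scalar factor depends on the shift.\<close>
lemma fom_residual:
  assumes dM: "Determinant.det (shift_mat M z) \<noteq> 0"
    and dH: "Determinant.det (shift_mat (arnoldi_H M b k) z) \<noteq> 0"
  shows "shift_mat M z *\<^sub>v fom_error M b k z =
    (- complex_of_real (cvec_norm b) * cofactor (arnoldi_H M b k) 0 (k - 1)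
      / Determinant.det (shift_mat (arnoldi_H M b k) z)) \<cdot>\<^sub>v arnoldi_rest M b k"
proof -
  let ?Q = "arnoldi_Q M b k" and ?H = "arnoldi_H M b k" and ?w = "arnoldi_rest M b k"
  let ?e = "complex_of_real (cvec_norm b) \<cdot>\<^sub>v unit_vec k 0"
  let ?Mz = "shift_mat M z" and ?Hz = "shift_mat ?H z"
  \<comment> \<open>The coordinates of the FOM approximation in the Arnoldi basis.\<close>
  define y where "y = mat_inv ?Hz *\<^sub>v ?e"
  have Q: "?Q \<in> carrier_mat n k" and w: "?w \<in> carrier_vec n" and H: "?H \<in> carrier_mat k k"
    and Mz: "?Mz \<in> carrier_mat n n" and Hz: "?Hz \<in> carrier_mat k k"
    using arnoldi_Q_carrier arnoldi_rest_carrier M b by auto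
  note invM = mat_inv_det[OF Mz dM] and invH = mat_inv_det[OF Hz dH]
  have y: "y \<in> carrier_vec k" using invH by (auto simp: y_def)
  have "?Hz *\<^sub>v y = ?e"
    unfolding y_def by (rule mat_inv_mult_vec(2)[OF Hz dH]) simp
  then have Hy: "?H *\<^sub>v y - z \<cdot>\<^sub>v y = ?e"
    using y by (simp add: shift_mat_mult_vec[of _ k])
  have "?Mz *\<^sub>v (?Q *\<^sub>v y) = ?Q *\<^sub>v (?H *\<^sub>v y) + y $ (k - 1) \<cdot>\<^sub>v ?w - z \<cdot>\<^sub>v (?Q *\<^sub>v y)"
    using M Q y by (simp add: shift_mat_mult_vec[of _ n] arnoldi_relation_mat)
  also have "\<dots> = ?Q *\<^sub>v (?H *\<^sub>v y) - z \<cdot>\<^sub>v (?Q *\<^sub>v y) + y $ (k - 1) \<cdot>\<^sub>v ?w"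
    using w Q by (intro eq_vecI) auto
  also have "?Q *\<^sub>v (?H *\<^sub>v y) - z \<cdot>\<^sub>v (?Q *\<^sub>v y) = ?Q *\<^sub>v ?e"
    using Q y H unfolding Hy[symmetric]
    by (subst mult_minus_distrib_mat_vec[of _ n k]) (auto simp: mult_mat_vec[of _ n k] intro: mult_mat_vec_carrier[of _ k k])
  \<comment> \<open>The approximation solves the shifted system up to its last coordinate times the
    rest vector.\<close>
  finally have MQy: "?Mz *\<^sub>v (?Q *\<^sub>v y) = b + y $ (k - 1) \<cdot>\<^sub>v ?w"
    by (simp add: arnoldi_Q_unit_vec)
  have "?Mz *\<^sub>v fom_error M b k z = ?Mz *\<^sub>v (mat_inv ?Mz *\<^sub>v b) - ?Mz *\<^sub>v (?Q *\<^sub>v y)"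
    using Mz invM Q y b unfolding fom_error_def y_def[symmetric]
    by (intro mult_minus_distrib_mat_vec[of _ n n]) auto
  also have "?Mz *\<^sub>v (mat_inv ?Mz *\<^sub>v b) = b"
    using mat_inv_mult_vec(2)[OF Mz dM b(1)] .
  also have "b - ?Mz *\<^sub>v (?Q *\<^sub>v y) = (- y $ (k - 1)) \<cdot>\<^sub>v ?w"
    using b w by (auto simp: MQy)
  \<comment> \<open>As \<open>?e\<close> is a multiple of the first unit vector, only the bottom
    left entry of the inverse matters. In the adjugate this is the cofactor with transposed indices
    \<open>0\<close> and \<open>k - 1\<close>.\<close>
  also have "y $ (k - 1) = complex_of_real (cvec_norm b) * (mat_inv ?Hz $$ (k - 1, 0))"
    using k invH(1) unfolding y_def
    by (subst mult_mat_vec[of _ k k]) auto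
  also have "mat_inv ?Hz $$ (k - 1, 0) = cofactor ?Hz 0 (k - 1) / Determinant.det ?Hz"
    using k dH carrier_matD[OF Hz] by (simp add: mat_inv_adj_mat[OF Hz] adj_mat_def)
  also have "cofactor ?Hz 0 (k - 1) = cofactor ?H 0 (k - 1)"
    using k by (intro cofactor_shift_mat_hessenberg) (auto simp: arnoldi_H_def arnoldi_h_def Let_def)
  finally show ?thesis by simp
qed

text \<open>The residuals for shifts \<open>z\<close> and \<open>0\<close> are multiples of the same
  vector with the same numerator, so their scalar factors differ by the ratio of the two
  determinants.\<close>

lemma fom_error_shift:
  assumes dM: "Determinant.det (shift_mat M z) \<noteq> 0" "Determinant.det M \<noteq> 0"
    and dH: "Determinant.det (shift_mat (arnoldi_H M b k) z) \<noteq> 0" "Determinant.det (arnoldi_H M b k) \<noteq> 0"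
  shows "fom_error M b k z =
    (Determinant.det (arnoldi_H M b k) / Determinant.det (shift_mat (arnoldi_H M b k) z)) \<cdot>\<^sub>v
      ((mat_inv (shift_mat M z) * M) *\<^sub>v fom_error M b k 0)"
proof -
  let ?H = "arnoldi_H M b k" and ?Mz = "shift_mat M z"
  let ?c = "Determinant.det ?H / Determinant.det (shift_mat ?H z)"
  note s0 = shift_mat_0[OF M] shift_mat_0[OF arnoldi_H_carrier[of M b k]]
  have Mz: "?Mz \<in> carrier_mat n n" using M by simp
  note inv = mat_inv_det[OF Mz dM(1)]
  have x0: "fom_error M b k 0 \<in> carrier_vec n" and xz: "fom_error M b k z \<in> carrier_vec n"
    using dM dH by (auto intro!: fom_error_carrier simp: s0)
  have M0: "M *\<^sub>v fom_error M b k 0 = (- complex_of_real (cvec_norm b) * cofactor ?H 0 (k - 1)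
      / Determinant.det ?H) \<cdot>\<^sub>v arnoldi_rest M b k"
    using fom_residual[of 0] dM(2) dH(2) unfolding s0 by blast
  \<comment> \<open>Only \<open>det H\<close> is cancelled here; nothing is divided by the cofactor
    or by the rest vector, either of which may be zero.\<close>
  have "?Mz *\<^sub>v fom_error M b k z = ?c \<cdot>\<^sub>v (M *\<^sub>v fom_error M b k 0)"
    unfolding M0 fom_residual[OF dM(1) dH(1)] smult_smult_assoc using dH(2) by simp
  then have "fom_error M b k z = mat_inv ?Mz *\<^sub>v (?c \<cdot>\<^sub>v (M *\<^sub>v fom_error M b k 0))"
    using mat_inv_mult_vec(1)[OF Mz dM(1) xz] by simp
  also have "\<dots> = ?c \<cdot>\<^sub>v (mat_inv ?Mz *\<^sub>v (M *\<^sub>v fom_error M b k 0))"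
    using inv(1) mult_mat_vec_carrier[OF M x0] by (rule mult_mat_vec)
  also have "mat_inv ?Mz *\<^sub>v (M *\<^sub>v fom_error M b k 0) = (mat_inv ?Mz * M) *\<^sub>v fom_error M b k 0"
    using assoc_mult_mat_vec[OF inv(1) M x0] by simp
  finally show ?thesis .
qed

end

subsection \<open>Contour integrals of matrix-valued functions\<close>

definition mat_contour_integrable ::
  "nat \<Rightarrow> nat \<Rightarrow> (real \<Rightarrow> complex) \<Rightarrow> (complex \<Rightarrow> complex mat) \<Rightarrow> bool" where
  "mat_contour_integrable nr nc \<gamma> F \<longleftrightarrow>
    (\<forall>i<nr. \<forall>j<nc. (\<lambda>z. F z $$ (i, j)) contour_integrable_on \<gamma>)"

text \<open>Each entry of the product is a finite linear combination of entries of
  \<open>F z\<close> with constant coefficients. Dimensions are required only on the path, because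
  \<open>mat_inv\<close> may be unspecified elsewhere.\<close>

lemma has_contour_integral_mult_mat_vec:
  assumes F: "mat_contour_integrable nr nc \<gamma> F"
    and c: "\<And>z. z \<in> path_image \<gamma> \<Longrightarrow> F z \<in> carrier_mat nr nc"
    and v: "v \<in> carrier_vec nc" and i: "i < nr"
  shows "((\<lambda>z. (F z *\<^sub>v v) $ i) has_contour_integral
    (mat_contour_integral nr nc \<gamma> F *\<^sub>v v) $ i) \<gamma>"
proof -
  have "((\<lambda>z. \<Sum>j<nc. F z $$ (i, j) * v $ j) has_contour_integral
      (\<Sum>j<nc. contour_integral \<gamma> (\<lambda>z. F z $$ (i, j)) * v $ j)) \<gamma>"
    using F i unfolding mat_contour_integrable_def
    by (intro has_contour_integral_sum has_contour_integral_rmul has_contour_integral_integral) auto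
  also have "(\<Sum>j<nc. contour_integral \<gamma> (\<lambda>z. F z $$ (i, j)) * v $ j)
      = (mat_contour_integral nr nc \<gamma> F *\<^sub>v v) $ i"
    using i v by (auto simp: mat_contour_integral_def scalar_prod_def atLeast0LessThan)
  finally show ?thesis
    using c i v by (elim has_contour_integral_eq) (simp add: mult_mat_vec_index[of _ nr nc])
qed

text \<open>Linearity once more, now for a constant matrix on the left: the shape of the Arnoldi
  approximation \<open>Q f(H) e\<close>.\<close>

lemma has_contour_integral_mult_mat_vec2:
  assumes F: "mat_contour_integrable nr nc \<gamma> F"
    and c: "\<And>z. z \<in> path_image \<gamma> \<Longrightarrow> F z \<in> carrier_mat nr nc"
    and v: "v \<in> carrier_vec nc" and Q: "Q \<in> carrier_mat n nr" and i: "i < n"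
  shows "((\<lambda>z. (Q *\<^sub>v (F z *\<^sub>v v)) $ i) has_contour_integral
    (Q *\<^sub>v (mat_contour_integral nr nc \<gamma> F *\<^sub>v v)) $ i) \<gamma>"
proof -
  have I: "mat_contour_integral nr nc \<gamma> F *\<^sub>v v \<in> carrier_vec nr"
    by (rule carrier_vecI) (simp add: mat_contour_integral_def)
  have "((\<lambda>z. \<Sum>l<nr. Q $$ (i, l) * (F z *\<^sub>v v) $ l) has_contour_integral
      (\<Sum>l<nr. Q $$ (i, l) * (mat_contour_integral nr nc \<gamma> F *\<^sub>v v) $ l)) \<gamma>"
    using has_contour_integral_mult_mat_vec[OF F c v]
    by (intro has_contour_integral_sum has_contour_integral_lmul) auto
  also have "(\<Sum>l<nr. Q $$ (i, l) * (mat_contour_integral nr nc \<gamma> F *\<^sub>v v) $ l)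
      = (Q *\<^sub>v (mat_contour_integral nr nc \<gamma> F *\<^sub>v v)) $ i"
    using mult_mat_vec_index[OF Q I i] by simp
  finally show ?thesis
  proof (rule has_contour_integral_eq)
    fix z assume "z \<in> path_image \<gamma>"
    then show "(\<Sum>l<nr. Q $$ (i, l) * (F z *\<^sub>v v) $ l) = (Q *\<^sub>v (F z *\<^sub>v v)) $ i"
      using mult_mat_vec_index[OF Q mult_mat_vec_carrier[OF c v] i] by simp
  qed
qed

section \<open>Holomorphy of determinants and of resolvent entries\<close>

text \<open>By the Leibniz formula the determinant is a polynomial in the entries.\<close>

lemma holomorphic_on_det:
  assumes "\<And>z. z \<in> S \<Longrightarrow> A z \<in> carrier_mat n n"
    and "\<And>i j. i < n \<Longrightarrow> j < n \<Longrightarrow> (\<lambda>z. A z $$ (i, j)) holomorphic_on S"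
  shows "(\<lambda>z. Determinant.det (A z :: complex mat)) holomorphic_on S"
proof -
  have "(\<lambda>z. \<Sum>p | p permutes {0..<n}. signof p * (\<Prod>i = 0..<n. A z $$ (i, p i))) holomorphic_on S"
    using assms(2) permutes_in_image by (intro holomorphic_intros) fastforce+
  then show ?thesis
    by (rule holomorphic_transform) (simp add: det_def'[OF assms(1)])
qed

lemma holomorphic_on_shift_mat:
  assumes "A \<in> carrier_mat n n" "i < n" "j < n"
  shows "(\<lambda>z. shift_mat A z $$ (i, j)) holomorphic_on S"
  using assms by (cases "i = j") (auto simp: shift_mat_index[of _ n] intro!: holomorphic_intros)

lemma holomorphic_on_det_shift_mat:
  assumes "A \<in> carrier_mat n n"
  shows "(\<lambda>z. Determinant.det (shift_mat A z)) holomorphic_on S"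
  using assms by (intro holomorphic_on_det[of _ _ n] holomorphic_on_shift_mat[of _ n]) auto

text \<open>By Cramer's rule the entry is a cofactor divided by the determinant, and both are
  determinants of matrices with holomorphic entries.\<close>

lemma holomorphic_on_mat_inv_shift_mat:
  assumes A: "A \<in> carrier_mat n n" and ij: "i < n" "j < n"
    and d: "\<And>z. z \<in> S \<Longrightarrow> Determinant.det (shift_mat A z) \<noteq> 0"
  shows "(\<lambda>z. mat_inv (shift_mat A z) $$ (i, j)) holomorphic_on S"
proof -
  have dim: "dim_row (shift_mat A z) = n" "dim_col (shift_mat A z) = n" for z
    using carrier_matD[OF shift_mat_carrier[OF A, of z]] by auto
  have "(\<lambda>z. mat_delete (shift_mat A z) j i $$ (a, c)) holomorphic_on S"
    if "a < n - 1" "c < n - 1" for a c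
    using that A ij dim by (auto simp: mat_delete_def intro!: holomorphic_on_shift_mat[of _ n])
  then have "(\<lambda>z. Determinant.det (mat_delete (shift_mat A z) j i)) holomorphic_on S"
    using A by (intro holomorphic_on_det[of _ _ "n - 1"] mat_delete_carrier) auto
  then have "(\<lambda>z. 1 / Determinant.det (shift_mat A z) * cofactor (shift_mat A z) j i) holomorphic_on S"
    unfolding cofactor_def using d by (intro holomorphic_intros holomorphic_on_det_shift_mat[OF A]) auto
  then show ?thesis
  proof (rule holomorphic_transform)
    fix z assume "z \<in> S"
    then show "1 / Determinant.det (shift_mat A z) * cofactor (shift_mat A z) j i
        = mat_inv (shift_mat A z) $$ (i, j)"
      using ij dim mat_inv_adj_mat[OF shift_mat_carrier[OF A] d] by (simp add: adj_mat_def)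
  qed
qed

section \<open>Integration of the pointwise error identity along the contour\<close>

theorem theorem3p3:
  fixes M :: "complex mat" and b :: "complex vec" and n k :: nat
    and f :: "complex \<Rightarrow> complex" and \<gamma> :: "real \<Rightarrow> complex"
  assumes "M \<in> carrier_mat n n" and "invertible_mat M"
    and "b \<in> carrier_vec n" and "b \<noteq> 0\<^sub>v n"
    and "1 \<le> k" and "arnoldi_reaches M b k"
    and "invertible_mat (arnoldi_H M b k)"
    and "valid_path \<gamma>" and "pathfinish \<gamma> = pathstart \<gamma>"
    and "encloses_positively \<gamma> (spectrum M \<union> spectrum (arnoldi_H M b k))"
    and "f analytic_on (path_image \<gamma> \<union> inside (path_image \<gamma>))"
  shows "mat_fun \<gamma> f M *\<^sub>v b - arnoldi_approx k \<gamma> f M b =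
    ((- 1 / (2 * complex_of_real pi * \<i>)) \<cdot>\<^sub>m
      mat_contour_integral n n \<gamma> (\<lambda>z.
        (f z * (Determinant.det (arnoldi_H M b k)
              / Determinant.det (shift_mat (arnoldi_H M b k) z)))
          \<cdot>\<^sub>m (mat_inv (shift_mat M z) * M)))
      *\<^sub>v fom_error M b k 0"
proof -
  note M = assms(1) and b = assms(3,4) and k = assms(5) and reaches = assms(6)
  define H Q e where "H = arnoldi_H M b k" and "Q = arnoldi_Q M b k"
    and "e = complex_of_real (cvec_norm b) \<cdot>\<^sub>v unit_vec k 0"
  define dM dH where "dM z = Determinant.det (shift_mat M z)"
    and "dH z = Determinant.det (shift_mat H z)" for z
  define c where "c = - 1 / (2 * complex_of_real pi * \<i>)"
  define \<xi> where "\<xi> = fom_error M b k"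
  have H: "H \<in> carrier_mat k k" and Q: "Q \<in> carrier_mat n k" and e: "e \<in> carrier_vec k"
    unfolding H_def Q_def e_def using arnoldi_Q_carrier[OF b(1)] by simp_all

  obtain T where T: "open T" "path_image \<gamma> \<subseteq> T" "f holomorphic_on T"
    using assms(11) unfolding analytic_on_holomorphic by auto
  \<comment> \<open>Removing the zeros of both determinants from a neighbourhood on which
    \<open>f\<close> is holomorphic leaves an open set on which all three integrands are
    holomorphic.\<close>
  define S where "S = T \<inter> {z. dM z * dH z \<noteq> 0}"
  have "open {z. dM z * dH z \<noteq> 0}"
    unfolding dM_def dH_def
    by (intro open_Collect_neq continuous_intros holomorphic_on_imp_continuous_on
        holomorphic_on_det_shift_mat[OF M] holomorphic_on_det_shift_mat[OF H])
  then have "open S" using T by (auto simp: S_def)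
  have fS: "f holomorphic_on S"
    using T by (auto simp: S_def intro: holomorphic_on_subset)
  have dS: "dM z \<noteq> 0" "dH z \<noteq> 0" if "z \<in> S" for z
    using that by (auto simp: S_def)
  \<comment> \<open>Enclosed points lie in \<open>inside (path_image \<gamma>)\<close>, which is
    disjoint from the path, so the path stays in \<open>S\<close>.\<close>
  have "z \<notin> spectrum M \<union> spectrum H" if "z \<in> path_image \<gamma>" for z
    using assms(10) that inside_no_overlap[of "path_image \<gamma>"]
    unfolding encloses_positively_def H_def by blast
  then have path: "path_image \<gamma> \<subseteq> S"
    using T shift_mat_det_neq_0 M H by (auto simp: S_def dM_def dH_def)
  have int: "g contour_integrable_on \<gamma>" if "g holomorphic_on S" for g
    using that \<open>open S\<close> assms(8) path by (rule contour_integrable_holomorphic_simple)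

  note invM = mat_inv_det(1)[OF shift_mat_carrier[OF M]]
    and invH = mat_inv_det(1)[OF shift_mat_carrier[OF H]]
  have holM: "(\<lambda>z. mat_inv (shift_mat M z) $$ (i, j)) holomorphic_on S" if "i < n" "j < n" for i j
    using holomorphic_on_mat_inv_shift_mat[OF M that] dS(1) by (simp add: dM_def)
  have holH: "(\<lambda>z. mat_inv (shift_mat H z) $$ (i, j)) holomorphic_on S" if "i < k" "j < k" for i j
    using holomorphic_on_mat_inv_shift_mat[OF H that] dS(2) by (simp add: dH_def)

  \<comment> \<open>\<open>F1\<close>, \<open>F2\<close> and \<open>G\<close> are the integrands of
    \<open>f(M)\<close>, \<open>f(H)\<close> and the right-hand side, without the common factor
    \<open>c\<close>.\<close>
  define F1 where "F1 z = f z \<cdot>\<^sub>m mat_inv (shift_mat M z)" for z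
  define F2 where "F2 z = f z \<cdot>\<^sub>m mat_inv (shift_mat H z)" for z
  define G where "G z = (f z * (Determinant.det H / dH z)) \<cdot>\<^sub>m (mat_inv (shift_mat M z) * M)" for z
  have carr: "F1 z \<in> carrier_mat n n" "F2 z \<in> carrier_mat k k" "G z \<in> carrier_mat n n" if "z \<in> S" for z
    using invM[of z] invH[of z] dS[OF that] M by (auto simp: F1_def F2_def G_def dM_def dH_def)
  have F1: "mat_contour_integrable n n \<gamma> F1"
    unfolding mat_contour_integrable_def
  proof (intro allI impI int)
    fix i j assume "i < n" "j < n"
    then have "(\<lambda>z. f z * mat_inv (shift_mat M z) $$ (i, j)) holomorphic_on S"
      by (intro holomorphic_intros fS holM)
    then show "(\<lambda>z. F1 z $$ (i, j)) holomorphic_on S"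
      by (rule holomorphic_transform)
        (use \<open>i < n\<close> \<open>j < n\<close> carrier_matD[OF invM] dS(1) in \<open>simp add: F1_def dM_def\<close>)
  qed
  have F2: "mat_contour_integrable k k \<gamma> F2"
    unfolding mat_contour_integrable_def
  proof (intro allI impI int)
    fix i j assume "i < k" "j < k"
    then have "(\<lambda>z. f z * mat_inv (shift_mat H z) $$ (i, j)) holomorphic_on S"
      by (intro holomorphic_intros fS holH)
    then show "(\<lambda>z. F2 z $$ (i, j)) holomorphic_on S"
      by (rule holomorphic_transform)
        (use \<open>i < k\<close> \<open>j < k\<close> carrier_matD[OF invH] dS(2) in \<open>simp add: F2_def dH_def\<close>)
  qed
  have G: "mat_contour_integrable n n \<gamma> G"
    unfolding mat_contour_integrable_def
  proof (intro allI impI int)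
    fix i j assume ij: "i < n" "j < n"
    have "(\<lambda>z. f z * (Determinant.det H / dH z) * (\<Sum>l<n. mat_inv (shift_mat M z) $$ (i, l) * M $$ (l, j)))
        holomorphic_on S"
      using ij dS unfolding dH_def
      by (intro holomorphic_intros fS holM holomorphic_on_det_shift_mat[OF H]) auto
    then show "(\<lambda>z. G z $$ (i, j)) holomorphic_on S"
    proof (rule holomorphic_transform)
      fix z assume "z \<in> S"
      then have "mat_inv (shift_mat M z) \<in> carrier_mat n n"
        using invM dS by (auto simp: dM_def)
      then show "f z * (Determinant.det H / dH z) * (\<Sum>l<n. mat_inv (shift_mat M z) $$ (i, l) * M $$ (l, j))
          = G z $$ (i, j)"
        using ij M by (simp add: G_def scalar_prod_def atLeast0LessThan)
    qed
  qed

  have dM0: "Determinant.det M \<noteq> 0" and dH0: "Determinant.det H \<noteq> 0"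
    using invertible_mat_det_neq_0[OF M assms(2)] invertible_mat_det_neq_0[OF H] assms(7)
    by (auto simp: H_def)
  have \<xi>0: "\<xi> 0 \<in> carrier_vec n"
    unfolding \<xi>_def using fom_error_carrier[OF M b reaches k, of 0] dM0 dH0
    by (simp add: H_def shift_mat_0[OF M] shift_mat_0[OF arnoldi_H_carrier])
  \<comment> \<open>Both sides are entry \<open>i\<close> of \<open>f z\<close> times the error
    \<open>\<xi> z\<close>: on the left by the definition of \<open>fom_error\<close>, on the right
    by \<open>fom_error_shift\<close>.\<close>
  have integrand: "(F1 z *\<^sub>v b) $ i - (Q *\<^sub>v (F2 z *\<^sub>v e)) $ i = (G z *\<^sub>v \<xi> 0) $ i"
    if "z \<in> path_image \<gamma>" "i < n" for z i
  proof -
    have z: "z \<in> S" using path that by auto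
    have iM: "mat_inv (shift_mat M z) \<in> carrier_mat n n" and iH: "mat_inv (shift_mat H z) \<in> carrier_mat k k"
      using invM[of z] invH[of z] dS[OF z] by (auto simp: dM_def dH_def)
    have "F1 z *\<^sub>v b = f z \<cdot>\<^sub>v (mat_inv (shift_mat M z) *\<^sub>v b)"
      using iM b by (auto simp: F1_def)
    moreover have "Q *\<^sub>v (F2 z *\<^sub>v e) = f z \<cdot>\<^sub>v (Q *\<^sub>v (mat_inv (shift_mat H z) *\<^sub>v e))"
    proof -
      have "F2 z *\<^sub>v e = f z \<cdot>\<^sub>v (mat_inv (shift_mat H z) *\<^sub>v e)"
        using iH e by (auto simp: F2_def)
      then show ?thesis
        using mult_mat_vec[OF Q mult_mat_vec_carrier[OF iH e]] by simp
    qed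
    moreover have "G z *\<^sub>v \<xi> 0 = f z \<cdot>\<^sub>v ((Determinant.det H / dH z) \<cdot>\<^sub>v ((mat_inv (shift_mat M z) * M) *\<^sub>v \<xi> 0))"
      using smult_mat_mult_vec[OF mult_carrier_mat[OF iM M] \<xi>0] by (simp add: G_def smult_smult_assoc)
    moreover have "(Determinant.det H / dH z) \<cdot>\<^sub>v ((mat_inv (shift_mat M z) * M) *\<^sub>v \<xi> 0) = \<xi> z"
      using fom_error_shift[OF M b reaches k, of z] dM0 dH0 dS[OF z]
      by (simp add: dM_def dH_def H_def \<xi>_def)
    moreover have "\<xi> z = mat_inv (shift_mat M z) *\<^sub>v b - Q *\<^sub>v (mat_inv (shift_mat H z) *\<^sub>v e)"
      by (simp add: \<xi>_def fom_error_def H_def Q_def e_def)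
    ultimately show ?thesis
      using that iM Q by (simp add: right_diff_distrib del: index_mult_mat_vec)
  qed

  let ?I1 = "mat_contour_integral n n \<gamma> F1" and ?I2 = "mat_contour_integral k k \<gamma> F2"
    and ?IG = "mat_contour_integral n n \<gamma> G"
  have I: "?I1 \<in> carrier_mat n n" "?I2 \<in> carrier_mat k k" "?IG \<in> carrier_mat n n"
    by (auto simp: mat_contour_integral_def)
  \<comment> \<open>The integrands agree on the path, so both expressions are contour integrals of
    the same function and coincide by uniqueness.\<close>
  have eq: "(?I1 *\<^sub>v b) $ i - (Q *\<^sub>v (?I2 *\<^sub>v e)) $ i = (?IG *\<^sub>v \<xi> 0) $ i" if "i < n" for i
  proof -
    have "((\<lambda>z. (F1 z *\<^sub>v b) $ i - (Q *\<^sub>v (F2 z *\<^sub>v e)) $ i) has_contour_integral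
        (?I1 *\<^sub>v b) $ i - (Q *\<^sub>v (?I2 *\<^sub>v e)) $ i) \<gamma>"
      using path carr b e Q that
      by (intro has_contour_integral_diff has_contour_integral_mult_mat_vec
          has_contour_integral_mult_mat_vec2[of k k _ _ _ _ n] F1 F2) auto
    then have "((\<lambda>z. (G z *\<^sub>v \<xi> 0) $ i) has_contour_integral
        (?I1 *\<^sub>v b) $ i - (Q *\<^sub>v (?I2 *\<^sub>v e)) $ i) \<gamma>"
      by (rule has_contour_integral_eq) (use integrand that in auto)
    moreover have "((\<lambda>z. (G z *\<^sub>v \<xi> 0) $ i) has_contour_integral (?IG *\<^sub>v \<xi> 0) $ i) \<gamma>"
      using path carr \<xi>0 that by (intro has_contour_integral_mult_mat_vec G) auto
    ultimately show ?thesis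
      by (rule has_contour_integral_unique)
  qed
  have "mat_fun \<gamma> f M *\<^sub>v b = c \<cdot>\<^sub>v (?I1 *\<^sub>v b)"
    using M I b by (auto simp: mat_fun_def F1_def[abs_def] c_def)
  moreover have "arnoldi_approx k \<gamma> f M b = c \<cdot>\<^sub>v (Q *\<^sub>v (?I2 *\<^sub>v e))"
  proof -
    have "mat_fun \<gamma> f H *\<^sub>v e = c \<cdot>\<^sub>v (?I2 *\<^sub>v e)"
      using H I e by (auto simp: mat_fun_def F2_def[abs_def] c_def)
    moreover have "arnoldi_approx k \<gamma> f M b = Q *\<^sub>v (mat_fun \<gamma> f H *\<^sub>v e)"
      using adjoint_arnoldi_Q_mult_b[OF M b reaches k]
      by (simp add: arnoldi_approx_def H_def Q_def e_def)
    ultimately show ?thesis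
      using mult_mat_vec[OF Q mult_mat_vec_carrier[OF I(2) e]] by simp
  qed
  moreover have "(c \<cdot>\<^sub>m ?IG) *\<^sub>v \<xi> 0 = c \<cdot>\<^sub>v (?IG *\<^sub>v \<xi> 0)"
    using I \<xi>0 by auto
  moreover have "c \<cdot>\<^sub>v (?I1 *\<^sub>v b) - c \<cdot>\<^sub>v (Q *\<^sub>v (?I2 *\<^sub>v e)) = c \<cdot>\<^sub>v (?IG *\<^sub>v \<xi> 0)"
  proof (rule eq_vecI)
    fix i assume "i < dim_vec (c \<cdot>\<^sub>v (?IG *\<^sub>v \<xi> 0))"
    then have "i < n" using I by simp
    then show "(c \<cdot>\<^sub>v (?I1 *\<^sub>v b) - c \<cdot>\<^sub>v (Q *\<^sub>v (?I2 *\<^sub>v e))) $ i = (c \<cdot>\<^sub>v (?IG *\<^sub>v \<xi> 0)) $ i"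
      using I Q by (simp del: index_mult_mat_vec flip: eq add: right_diff_distrib)
  qed (use I Q in auto)
  ultimately show ?thesis
    by (simp add: c_def G_def[abs_def] H_def \<xi>_def dH_def)
qed

end
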